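(* Let $\alpha\in(0,1]$ be fixed. Let $\bar\mu\in\mathbb{R}_+$ be the positive solution of $\bar\mu-\log(2+\bar\mu)=1$. Assume $\mu,\tau_\alpha\in\mathbb{R}_+$ satisfy $\mu\ge\bar\mu$ and $\tau_\alpha=\frac{\mu+1}{2}\gamma_\alpha$, where $\gamma_\alpha:=-t_c(\alpha)^{-1}$. Then $$\varphi_{ss}^{\mu,\tau_\alpha}(\alpha)\le\varphi_c(\alpha).$$
   Context: $(\Omega,\mathcal{F},\mathbb{P})$ is a probability space and $\Xi:\Omega\to\mathbb{R}^d$ is a random vector. $\mathcal{X}=\{x\in\mathbb{R}^n : g(x)\ge 0\}$ is nonempty and compact, with $g:\mathbb{R}^n\to\mathbb{R}^m$ twice differentiable. The objective $\varphi:\mathbb{R}^n\to\mathbb{R}$ is twice continuously differentiable. The scalar function $f(x,\xi)$, $x\in\mathbb{R}^n$, $\xi\in\mathbb{R}^d$, is real-valued and twice continuously differentiable. $Z(x):=f(x,\Xi)$, with cumulative distribution function $F_{Z(x)}(t)=\mathbb{P}(Z(x)\le t)$. Write $[a]_+:=\max\{a,0\}$. Standing assumption: there exists $\kappa>0$ such that, for every $x\in\mathcal{X}$, $F_{Z(x)}(t)$ is Lipschitz continuous in $t\in[-\kappa,\kappa]$. CVaR problem: minimize $\varphi(x)$ over $x\in\mathcal{X}$ subject to $\text{CVaR}_{1-\alpha}(f(x,\Xi))\le 0$, where $$\text{CVaR}_{1-\alpha}(Z):=\inf_{t\in\mathbb{R}}\{t+\alpha^{-1}\mathbb{E}[[Z-t]_+]\}.$$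 $\varphi_c(\alpha)$ denotes its optimal value and $x_c(\alpha)$ an optimal solution. Set $Z_c(\alpha):=f(x_c(\alpha),\Xi)$, and let $$t_c(\alpha)\in\mathrm{argmin}_{t\in\mathbb{R}}\{t+\alpha^{-1}\mathbb{E}[[Z_c(\alpha)-t]_+]\}$$ be a minimizer chosen with $t_c(\alpha)<0$, so that $\gamma_\alpha>0$. SigVaR problem: for $\mu,\tau>0$ let $\psi_{ss}^{\mu,\tau}(z):=\left[2\,\frac{1+\mu}{\mu+e^{-\tau z}}-1\right]_+$ and $$\text{SigVaR}_{1-\alpha}^{\mu,\tau}(Z):=\inf\{t\in\mathbb{R} : \mathbb{E}[\psi_{ss}^{\mu,\tau}(Z-t)]\le\alpha\}.$$ $\varphi_{ss}^{\mu,\tau}(\alpha)$ denotes the optimal value of minimizing $\varphi(x)$ over $x\in\mathcal{X}$ subject to $\text{SigVaR}_{1-\alpha}^{\mu,\tau}(f(x,\Xi))\le 0$, equivalently subject to $\mathbb{E}[\psi_{ss}^{\mu,\tau}(f(x,\Xi))]\le\alpha$. *)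

theory Defs
  imports "HOL-Probability.Probability"
begin

definition twice_differentiable :: "('a::real_normed_vector \<Rightarrow> 'b::real_normed_vector) \<Rightarrow> bool" where
  "twice_differentiable h \<longleftrightarrow>
     (\<exists>h' :: 'a \<Rightarrow> 'a \<Rightarrow>\<^sub>L 'b.
        (\<forall>x. (h has_derivative blinfun_apply (h' x)) (at x)) \<and>
        (\<forall>x. h' differentiable (at x)))"

definition twice_continuously_differentiable ::
    "('a::real_normed_vector \<Rightarrow> 'b::real_normed_vector) \<Rightarrow> bool" where
  "twice_continuously_differentiable h \<longleftrightarrow>
     (\<exists>(h' :: 'a \<Rightarrow> 'a \<Rightarrow>\<^sub>L 'b) (h'' :: 'a \<Rightarrow> 'a \<Rightarrow>\<^sub>L 'a \<Rightarrow>\<^sub>L 'b).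
        (\<forall>x. (h has_derivative blinfun_apply (h' x)) (at x)) \<and>
        (\<forall>x. (h' has_derivative blinfun_apply (h'' x)) (at x)) \<and>
        continuous_on UNIV h'')"

text \<open>
  The expectation of the nonnegative variable \<open>max (Z - t) 0\<close> is taken in \<open>[0, \<infinity>]\<close>, since
  \<open>Z\<close> need not be integrable: a Bochner integral would give the value 0 to a divergent
  expectation. Accordingly, CVaR takes values in the extended reals.
\<close>

definition cvar_objective :: "'w measure \<Rightarrow> real \<Rightarrow> ('w \<Rightarrow> real) \<Rightarrow> real \<Rightarrow> ereal" where
  "cvar_objective M \<alpha> Z t =
     ereal t + ereal (inverse \<alpha>) * enn2ereal (\<integral>\<^sup>+\<omega>. ennreal (max (Z \<omega> - t) 0) \<partial>M)"

text \<open>\<open>cvar M \<alpha>\<close> and \<open>sigvar M \<alpha> \<mu> \<tau>\<close> are at confidence level \<open>1 - \<alpha>\<close>.\<close>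

definition cvar :: "'w measure \<Rightarrow> real \<Rightarrow> ('w \<Rightarrow> real) \<Rightarrow> ereal" where
  "cvar M \<alpha> Z = (INF t. cvar_objective M \<alpha> Z t)"

definition psi_ss :: "real \<Rightarrow> real \<Rightarrow> real \<Rightarrow> real" where
  "psi_ss \<mu> \<tau> z = max (2 * ((1 + \<mu>) / (\<mu> + exp (- \<tau> * z))) - 1) 0"

text \<open>
  For \<open>\<mu>, \<tau> > 0\<close> the function \<open>psi_ss \<mu> \<tau>\<close> takes values in \<open>[0, 1 + 2 / \<mu>)\<close>, so the
  Bochner integral below is the expectation for every random variable \<open>Z\<close>.
\<close>

definition sigvar :: "'w measure \<Rightarrow> real \<Rightarrow> real \<Rightarrow> real \<Rightarrow> ('w \<Rightarrow> real) \<Rightarrow> ereal" where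
  "sigvar M \<alpha> \<mu> \<tau> Z =
     (INF t \<in> {t. (\<integral>\<omega>. psi_ss \<mu> \<tau> (Z \<omega> - t) \<partial>M) \<le> \<alpha>}. ereal t)"

definition cvar_feasible ::
    "'w measure \<Rightarrow> 'x set \<Rightarrow> ('x \<Rightarrow> 'y \<Rightarrow> real) \<Rightarrow> ('w \<Rightarrow> 'y) \<Rightarrow> real \<Rightarrow> 'x set" where
  "cvar_feasible M X f \<Xi> \<alpha> = {x \<in> X. cvar M \<alpha> (\<lambda>\<omega>. f x (\<Xi> \<omega>)) \<le> 0}"

definition sigvar_feasible ::
    "'w measure \<Rightarrow> 'x set \<Rightarrow> ('x \<Rightarrow> 'y \<Rightarrow> real) \<Rightarrow> ('w \<Rightarrow> 'y) \<Rightarrow> real \<Rightarrow> real \<Rightarrow> real \<Rightarrow> 'x set" where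
  "sigvar_feasible M X f \<Xi> \<alpha> \<mu> \<tau> = {x \<in> X. sigvar M \<alpha> \<mu> \<tau> (\<lambda>\<omega>. f x (\<Xi> \<omega>)) \<le> 0}"

text \<open>The optimal value of an infeasible minimization problem is \<open>\<infinity>\<close>.\<close>

definition optimal_value :: "('x \<Rightarrow> real) \<Rightarrow> 'x set \<Rightarrow> ereal" where
  "optimal_value \<phi> S = (INF x \<in> S. ereal (\<phi> x))"

end

theory Submission imports Defs begin

text \<open>
  The optimal point \<open>xc\<close> of the CVaR problem is feasible for the SigVaR problem, whose optimal value
  is therefore at most \<open>\<phi> xc\<close>. Indeed, dividing the CVaR constraint at its minimizer \<open>tc < 0\<close> by
  \<open>- tc\<close> turns it into \<open>\<E>[max (1 + \<gamma> * Z) 0] \<le> \<alpha>\<close>, while feasibility for the SigVaR problem follows from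
  \<open>\<E>[psi_ss \<mu> \<tau> Z] \<le> \<alpha>\<close>. So it is enough that the sigmoid lies below the ramp
  \<open>max (1 + \<gamma> * z) 0\<close> pointwise (\<open>psi_ss_le_ramp\<close>).

  The value \<open>\<tau> = (\<mu> + 1) / 2 * \<gamma>\<close> makes the sigmoid tangent to the ramp at \<open>z = 0\<close>, where both are
  equal to 1. After clearing denominators, with \<open>u = \<gamma> * z\<close>, the comparison is
  \<open>2 - \<mu> * u \<le> (2 + u) * exp (- (\<mu> + 1) / 2 * u)\<close> for \<open>u \<ge> - 1\<close> (\<open>exp_above_moebius\<close>). The difference of
  the logarithms of the two sides has a rational derivative whose sign is easily read off, and which
  makes \<open>u = 0\<close> the minimum of that difference as soon as \<open>\<mu> \<ge> 2\<close>. The defining equation of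
  \<open>\<mu>bar\<close> forces \<open>\<mu>bar \<ge> 2\<close>.
\<close>

text \<open>
  Where the left-hand side is positive, the function
  \<open>k v = ln (2 + v) - ln (2 - \<mu> * v) - (\<mu> + 1) / 2 * v\<close> vanishes at 0, and its derivative is
  \<open>(\<mu> + 1) / 2 * v * (2 * (\<mu> - 1) + \<mu> * v) / ((2 + v) * (2 - \<mu> * v))\<close>. For \<open>\<mu> \<ge> 2\<close> and
  \<open>v \<ge> - 1\<close> the second linear factor is nonnegative, so that \<open>k\<close> decreases up to 0 and increases from
  there on.
\<close>

lemma exp_above_moebius:
  fixes \<mu> u :: real
  assumes \<mu>: "2 \<le> \<mu>" and u: "- 1 \<le> u"
  shows "2 - \<mu> * u \<le> (2 + u) * exp (- ((\<mu> + 1) / 2 * u))"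
proof (cases "\<mu> * u < 2")
  case False
  have "0 \<le> (2 + u) * exp (- ((\<mu> + 1) / 2 * u))" using u by simp
  with False show ?thesis by linarith
next
  case True
  define k where "k = (\<lambda>v. ln (2 + v) - ln (2 - \<mu> * v) - (\<mu> + 1) / 2 * v)"
  define k' where "k' = (\<lambda>v. (\<mu> + 1) / 2 * (v * (2 * (\<mu> - 1) + \<mu> * v)) / ((2 + v) * (2 - \<mu> * v)))"
  have deriv: "(k has_real_derivative k' v) (at v)" if "- 1 \<le> v" "\<mu> * v < 2" for v
  proof -
    have "(k has_real_derivative (1 / (2 + v) + \<mu> / (2 - \<mu> * v) - (\<mu> + 1) / 2)) (at v)"
      unfolding k_def using that by (auto intro!: derivative_eq_intros)
    moreover have "1 / (2 + v) + \<mu> / (2 - \<mu> * v) - (\<mu> + 1) / 2 = k' v"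
      unfolding k'_def using that by (simp add: divide_simps) (simp add: algebra_simps)
    ultimately show ?thesis by simp
  qed
  have factor: "0 \<le> 2 * (\<mu> - 1) + \<mu> * v" if "- 1 \<le> v" for v
    using mult_left_mono[OF that, of \<mu>] \<mu> by simp
  have "k 0 \<le> k u"
  proof (cases "0 \<le> u")
    case True
    show ?thesis
    proof (rule DERIV_nonneg_imp_nondecreasing[OF True])
      fix v assume v: "0 \<le> v" "v \<le> u"
      have "\<mu> * v < 2" using \<open>\<mu> * u < 2\<close> mult_left_mono[OF v(2), of \<mu>] \<mu> by linarith
      moreover have "0 \<le> k' v"
        unfolding k'_def using v \<mu> \<open>\<mu> * v < 2\<close>
        by (intro divide_nonneg_nonneg mult_nonneg_nonneg factor) auto
      ultimately show "\<exists>y. (k has_real_derivative y) (at v) \<and> 0 \<le> y"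
        using deriv[of v] v by auto
    qed
  next
    case False
    show ?thesis
    proof (rule DERIV_nonpos_imp_nonincreasing[of u 0 k])
      show "u \<le> 0" using False by simp
      fix v assume v: "u \<le> v" "v \<le> 0"
      have "\<mu> * v \<le> 0" using v \<mu> by (simp add: mult_nonneg_nonpos)
      have "(\<mu> + 1) / 2 * (v * (2 * (\<mu> - 1) + \<mu> * v)) \<le> 0"
        using v u \<mu> by (intro mult_nonneg_nonpos mult_nonpos_nonneg factor) auto
      hence "k' v \<le> 0"
        unfolding k'_def using v u \<open>\<mu> * v \<le> 0\<close> by (intro divide_nonpos_nonneg) auto
      with \<open>\<mu> * v \<le> 0\<close> show "\<exists>y. (k has_real_derivative y) (at v) \<and> y \<le> 0"
        using deriv[of v] v u by auto
    qed
  qed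
  hence "ln (2 - \<mu> * u) \<le> ln (2 + u) - (\<mu> + 1) / 2 * u" by (simp add: k_def)
  hence "exp (ln (2 - \<mu> * u)) \<le> exp (ln (2 + u) - (\<mu> + 1) / 2 * u)" by simp
  also have "\<dots> = exp (ln (2 + u)) * exp (- ((\<mu> + 1) / 2 * u))"
    by (simp only: diff_conv_add_uminus exp_add)
  finally show ?thesis using True u by (simp only: exp_ln)
qed

text \<open>
  To the left of \<open>u = - 1\<close>, where the ramp has already reached zero, the sigmoid is cut off too: by
  monotonicity this needs to be known at \<open>u = - 1\<close> only.
\<close>

lemma psi_ss_le_ramp:
  fixes \<mu> \<gamma> z :: real
  assumes \<mu>: "2 \<le> \<mu>"
  shows "psi_ss \<mu> ((\<mu> + 1) / 2 * \<gamma>) z \<le> max (1 + \<gamma> * z) 0"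
proof -
  define u where "u = \<gamma> * z"
  define e where "e = exp (- ((\<mu> + 1) / 2 * u))"
  have psi: "psi_ss \<mu> ((\<mu> + 1) / 2 * \<gamma>) z = max (2 * ((1 + \<mu>) / (\<mu> + e)) - 1) 0"
    by (simp add: psi_ss_def e_def u_def mult.assoc)
  have pos: "0 < \<mu> + e" using \<mu> by (simp add: e_def add_pos_pos)
  show ?thesis
  proof (cases "- 1 \<le> u")
    case True
    from exp_above_moebius[OF \<mu> True] have "2 * (1 + \<mu>) \<le> (2 + u) * (\<mu> + e)"
      by (simp add: e_def algebra_simps)
    hence "2 * ((1 + \<mu>) / (\<mu> + e)) \<le> 2 + u"
      using pos by (simp add: divide_simps)
    thus ?thesis unfolding psi u_def by linarith
  next
    case False
    have "2 + \<mu> \<le> exp ((\<mu> + 1) / 2)" using exp_above_moebius[OF \<mu>, of "- 1"] by simp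
    also have "\<dots> \<le> e"
    proof -
      have "(\<mu> + 1) / 2 * u \<le> (\<mu> + 1) / 2 * - 1" using False \<mu> by (intro mult_left_mono) auto
      thus ?thesis unfolding e_def exp_le_cancel_iff by linarith
    qed
    finally have "2 * ((1 + \<mu>) / (\<mu> + e)) \<le> 1" using pos by (simp add: divide_simps)
    thus ?thesis unfolding psi by linarith
  qed
qed

text \<open>
  The fixed-point equation \<open>m = 1 + ln (2 + m)\<close> bootstraps: \<open>m > 0\<close> gives \<open>m > 1\<close>, and then
  \<open>m > 1 + ln 3 > 2\<close>.
\<close>

lemma two_le_log_fixed_point:
  fixes m :: real
  assumes "0 < m" and "m - ln (2 + m) = 1"
  shows "2 \<le> m"
proof -
  have "0 < ln (2 + m)" using assms(1) by simp
  hence "1 < m" using assms(2) by linarith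
  hence "exp 1 \<le> 2 + m" using exp_le by linarith
  hence "1 \<le> ln (2 + m)" using assms(1) by (simp add: ln_ge_iff)
  thus ?thesis using assms(2) by linarith
qed

text \<open>
  The constraint in \<open>[0, \<infinity>]\<close> forces the expected excess to be finite, and scaling it by
  \<open>- inverse t > 0\<close> gives the expected ramp.
\<close>

lemma expected_ramp_le:
  fixes Z :: "'w \<Rightarrow> real"
  assumes Z [measurable]: "Z \<in> borel_measurable M" and \<alpha>: "0 < \<alpha>" and t: "t < 0"
    and obj: "cvar_objective M \<alpha> Z t \<le> 0"
  shows "(\<integral>\<^sup>+\<omega>. ennreal (max (1 + - inverse t * Z \<omega>) 0) \<partial>M) \<le> ennreal \<alpha>"
proof -
  define N where "N = (\<integral>\<^sup>+\<omega>. ennreal (max (Z \<omega> - t) 0) \<partial>M)"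
  have obj': "ereal t + ereal (inverse \<alpha>) * enn2ereal N \<le> 0"
    using obj by (simp add: cvar_objective_def N_def)
  obtain r where r: "0 \<le> r" "N = ennreal r"
  proof (cases N)
    case (real r) with that show ?thesis by blast
  next
    case top with obj' \<alpha> show ?thesis by (simp add: top_ereal_def)
  qed
  have "t + inverse \<alpha> * r \<le> 0" using obj' r by (simp add: zero_ereal_def)
  hence "- inverse t * r \<le> \<alpha>" using \<alpha> t by (simp add: field_simps)
  have "max (1 + - inverse t * z) 0 = - inverse t * max (z - t) 0" for z
    using t by (simp add: max_def field_simps)
  hence "ennreal (max (1 + - inverse t * z) 0) = ennreal (- inverse t) * ennreal (max (z - t) 0)" for z
    using t by (simp only: ennreal_mult max.cobounded2 neg_0_le_iff_le inverse_nonpositive_iff_nonpositive less_imp_le)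
  hence "(\<integral>\<^sup>+\<omega>. ennreal (max (1 + - inverse t * Z \<omega>) 0) \<partial>M)
      = (\<integral>\<^sup>+\<omega>. ennreal (- inverse t) * ennreal (max (Z \<omega> - t) 0) \<partial>M)"
    by (simp only:)
  also have "\<dots> = ennreal (- inverse t) * N"
    unfolding N_def by (rule nn_integral_cmult) measurable
  also have "\<dots> = ennreal (- inverse t * r)" using r t by (simp add: ennreal_mult[symmetric])
  also have "\<dots> \<le> ennreal \<alpha>" by (rule ennreal_leI) fact
  finally show ?thesis .
qed

lemma sigvar_nonpos_if_cvar_objective_nonpos:
  fixes Z :: "'w \<Rightarrow> real"
  assumes Z: "Z \<in> borel_measurable M" and \<alpha>: "0 < \<alpha>" and t: "t < 0"
    and obj: "cvar_objective M \<alpha> Z t \<le> 0" and \<mu>: "2 \<le> \<mu>"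
  shows "sigvar M \<alpha> \<mu> ((\<mu> + 1) / 2 * - inverse t) Z \<le> 0"
proof -
  let ?\<tau> = "(\<mu> + 1) / 2 * - inverse t"
  have "(\<integral>\<^sup>+\<omega>. ennreal (psi_ss \<mu> ?\<tau> (Z \<omega>)) \<partial>M)
      \<le> (\<integral>\<^sup>+\<omega>. ennreal (max (1 + - inverse t * Z \<omega>) 0) \<partial>M)"
    by (intro nn_integral_mono ennreal_leI psi_ss_le_ramp \<mu>)
  also have "\<dots> \<le> ennreal \<alpha>" by (rule expected_ramp_le[OF Z \<alpha> t obj])
  finally have "(\<integral>\<omega>. psi_ss \<mu> ?\<tau> (Z \<omega>) \<partial>M) \<le> \<alpha>"
    using \<alpha> by (intro integral_real_bounded) auto
  hence "sigvar M \<alpha> \<mu> ?\<tau> Z \<le> ereal 0"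
    unfolding sigvar_def by (intro INF_lower) simp
  thus ?thesis by (simp add: zero_ereal_def)
qed

lemma twice_continuously_differentiable_imp_continuous:
  assumes "twice_continuously_differentiable h"
  shows "continuous_on UNIV h"
  using assms unfolding twice_continuously_differentiable_def
  by (meson continuous_at_imp_continuous_on has_derivative_continuous)

theorem proposition1:
  fixes M :: "'w measure"
    and \<Xi> :: "'w \<Rightarrow> real ^ 'd"
    and g :: "real ^ 'n \<Rightarrow> real ^ 'm"
    and X :: "(real ^ 'n) set"
    and \<phi> :: "real ^ 'n \<Rightarrow> real"
    and f :: "real ^ 'n \<Rightarrow> real ^ 'd \<Rightarrow> real"
    and \<kappa> \<alpha> \<mu>bar \<mu> \<gamma> \<tau> tc :: real
    and xc :: "real ^ 'n"
  assumes "prob_space M"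
    and "\<Xi> \<in> borel_measurable M"
    and "X = {x. \<forall>i. g x $ i \<ge> 0}"
    and "X \<noteq> {}" and "compact X"
    and "twice_differentiable g"
    and "twice_continuously_differentiable \<phi>"
    and "twice_continuously_differentiable (\<lambda>(x, \<xi>). f x \<xi>)"
    and "\<kappa> > 0"
    and "\<forall>x\<in>X. \<exists>L. L-lipschitz_on {-\<kappa>..\<kappa>} (cdf (distr M borel (\<lambda>\<omega>. f x (\<Xi> \<omega>))))"
    and "0 < \<alpha>" and "\<alpha> \<le> 1"
    and "is_arg_min \<phi> (\<lambda>x. x \<in> cvar_feasible M X f \<Xi> \<alpha>) xc"
    and "is_arg_min (cvar_objective M \<alpha> (\<lambda>\<omega>. f xc (\<Xi> \<omega>))) (\<lambda>t. True) tc"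
    and "tc < 0"
    and "\<gamma> = - inverse tc"
    and "\<mu>bar > 0" and "\<mu>bar - ln (2 + \<mu>bar) = 1"
    and "\<mu> \<ge> \<mu>bar"
    and "\<tau> = (\<mu> + 1) / 2 * \<gamma>"
  shows "optimal_value \<phi> (sigvar_feasible M X f \<Xi> \<alpha> \<mu> \<tau>)
           \<le> optimal_value \<phi> (cvar_feasible M X f \<Xi> \<alpha>)"
proof -
  note \<Xi> = assms(2) and smooth = assms(8) and \<alpha> = assms(11)
    and xc_min = assms(13) and tc_min = assms(14) and tc = assms(15)
    and \<gamma> = assms(16) and \<mu>bar = assms(17,18) and \<mu> = assms(19) and \<tau> = assms(20)
  let ?Z = "\<lambda>\<omega>. f xc (\<Xi> \<omega>)"
  have xc: "xc \<in> cvar_feasible M X f \<Xi> \<alpha>"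
    and xc_le: "\<And>x. x \<in> cvar_feasible M X f \<Xi> \<alpha> \<Longrightarrow> \<phi> xc \<le> \<phi> x"
    using xc_min by (auto simp: is_arg_min_linorder)
  have "continuous_on UNIV (\<lambda>\<xi>. (\<lambda>(x, \<xi>). f x \<xi>) (xc, \<xi>))"
    using twice_continuously_differentiable_imp_continuous[OF smooth]
    by (rule continuous_on_compose2) (auto intro!: continuous_intros)
  hence "f xc \<in> borel_measurable borel"
    by (intro borel_measurable_continuous_onI) simp
  with \<Xi> have Z: "?Z \<in> borel_measurable M" by measurable
  have "cvar_objective M \<alpha> ?Z tc \<le> cvar M \<alpha> ?Z"
    using tc_min unfolding cvar_def is_arg_min_linorder by (intro INF_greatest) simp
  also have "\<dots> \<le> 0" using xc by (simp add: cvar_feasible_def)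
  finally have obj: "cvar_objective M \<alpha> ?Z tc \<le> 0" .
  have "2 \<le> \<mu>" using two_le_log_fixed_point[OF \<mu>bar] \<mu> by simp
  from sigvar_nonpos_if_cvar_objective_nonpos[OF Z \<alpha> tc obj this] xc
  have "xc \<in> sigvar_feasible M X f \<Xi> \<alpha> \<mu> \<tau>"
    by (simp add: sigvar_feasible_def cvar_feasible_def \<tau> \<gamma>)
  hence "optimal_value \<phi> (sigvar_feasible M X f \<Xi> \<alpha> \<mu> \<tau>) \<le> ereal (\<phi> xc)"
    unfolding optimal_value_def by (rule INF_lower)
  also have "\<dots> \<le> optimal_value \<phi> (cvar_feasible M X f \<Xi> \<alpha>)"
    unfolding optimal_value_def using xc_le by (intro INF_greatest) simp
  finally show ?thesis .
qed

end
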